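(* Let $F: Q \to \mathbf{E}^*$ be a continuous, bounded (with constant $L_F$), and $\delta$-monotone operator. Let $N\ge 1$, $x^1\in Q$, and let $x^1,\dots,x^N$ be generated by the mirror descent iteration $$x^{k+1} = \arg\min_{x \in Q} \left\{ \langle F(x^k), x \rangle + \frac{1}{\gamma_k} V_{\psi}(x,x^k) \right\},\qquad k=1,\dots,N,$$ with step sizes $\gamma_k = \frac{\sqrt{2 \sigma}}{L_F \sqrt{k}}$, $k=1,\dots,N$. Set $\overline{x} = \frac{1}{N} \sum_{k= 1}^{N} x^k$. Then $$\operatorname{Gap}(\overline{x}) \leq \frac{L_F \left( 2+ R \right)}{\sqrt{2\sigma}} \cdot \frac{1}{\sqrt{N}} + \delta = O\left(\frac{1}{\sqrt{N}}\right) + \delta .$$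
   Context: $(\mathbf{E},\|\cdot\|)$ is a finite-dimensional normed real vector space (arbitrary norm), $\mathbf{E}^*$ its dual with norm $\|y\|_*=\max\{\langle y,x\rangle : \|x\|\le 1\}$, where $\langle y,x\rangle$ is the value of $y\in\mathbf{E}^*$ at $x\in\mathbf{E}$. $Q\subset\mathbf{E}$ is a (nonempty) convex compact set. The prox-function $\psi:Q\to\mathbb{R}$ is proper, closed, differentiable and $\sigma$-strongly convex ($\sigma>0$) with respect to $\|\cdot\|$; its Bregman divergence is $V_\psi(x,y)=\psi(x)-\psi(y)-\langle\nabla\psi(y),x-y\rangle$ for $x,y\in Q$. It is assumed that $R>0$ is a constant with $V_\psi(x,y)\le R<\infty$ for all $x,y\in Q$. The operator $F:Q\to\mathbf{E}^*$ is $\delta$-monotone if $\langle F(y)-F(x),y-x\rangle\ge-\delta$ for all $x,y\in Q$, where $\delta\ge 0$ (the case $\delta=0$ is ordinary monotonicity). It is bounded with constant $L_F>0$ if $\|F(x)\|_*\le L_F$ for all $x\in Q$. The underlying problem is to find $x^*\in Q$ with $\langle F(x),x^*-x\rangle\le 0$ for all $x\in Q$. The restricted gap function is $\operatorname{Gap}(\widehat{x})=\max_{u\in Q}\langle F(u),\widehat{x}-u\rangle$. $O(\cdot)$ refers to $N\to\infty$ with all other parameters fixed. *)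

theory Defs
  imports "HOL-Analysis.Analysis" "HOL-Library.Landau_Symbols"
begin

text \<open>
  The dual space is the type \<open>'a \<Rightarrow>\<^sub>L real\<close> and the dual norm is its library norm,
  the operator norm; the following lemma relates it to the supremum over the unit ball.
\<close>

lemma norm_dual_eq_SUP:
  fixes y :: "'a::real_normed_vector \<Rightarrow>\<^sub>L real"
  shows "norm y = (SUP x\<in>{x. norm x \<le> 1}. blinfun_apply y x)"
proof (rule antisym)
  have le: "blinfun_apply y x \<le> norm y" if "norm x \<le> 1" for x
  proof -
    have "blinfun_apply y x \<le> norm (blinfun_apply y x)" by simp
    also have "\<dots> \<le> norm y * norm x" by (rule norm_blinfun)
    also have "\<dots> \<le> norm y * 1" using that by (intro mult_left_mono) auto
    finally show ?thesis by simp
  qed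
  have bdd: "bdd_above (blinfun_apply y ` {x. norm x \<le> 1})"
    using le by (intro bdd_aboveI[of _ "norm y"]) auto
  let ?S = "SUP x\<in>{x. norm x \<le> 1}. blinfun_apply y x"
  show "?S \<le> norm y"
    using le by (intro cSUP_least) (auto intro: exI[of _ 0])
  have up: "blinfun_apply y x \<le> ?S" if "norm x \<le> 1" for x
    using bdd that by (intro cSUP_upper) auto
  show "norm y \<le> ?S"
  proof (rule norm_blinfun_bound)
    show "0 \<le> ?S" using up[of 0] by (simp add: blinfun.zero_right)
    fix x
    show "norm (blinfun_apply y x) \<le> ?S * norm x"
    proof (cases "x = 0")
      case False
      have "blinfun_apply y ((1 / norm x) *\<^sub>R x) \<le> ?S" "blinfun_apply y ((- 1 / norm x) *\<^sub>R x) \<le> ?S"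
        using False by (auto intro!: up)
      then have "\<bar>blinfun_apply y x\<bar> / norm x \<le> ?S"
        by (auto simp: blinfun.scaleR_right blinfun.minus_right abs_if)
      then show ?thesis using False by (simp add: divide_le_eq)
    qed (simp add: blinfun.zero_right)
  qed
qed

definition strongly_convex_on ::
    "real \<Rightarrow> 'a::real_normed_vector set \<Rightarrow> ('a \<Rightarrow> real) \<Rightarrow> bool" where
  "strongly_convex_on \<sigma> Q \<psi> \<longleftrightarrow> convex Q \<and>
     (\<forall>x\<in>Q. \<forall>y\<in>Q. \<forall>t\<in>{0..1}.
        \<psi> (t *\<^sub>R x + (1 - t) *\<^sub>R y)
          \<le> t * \<psi> x + (1 - t) * \<psi> y - \<sigma> / 2 * t * (1 - t) * (norm (x - y))\<^sup>2)"

text \<open>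
  The second argument is a gradient of \<open>\<psi>\<close>. It is used with derivatives taken within a
  convex set \<open>Q\<close>; if \<open>Q\<close> has empty interior such a gradient need not be unique, but by
  the lemma below the divergence on \<open>Q\<close> does not depend on its choice.
\<close>

definition bregman ::
    "('a::real_normed_vector \<Rightarrow> real) \<Rightarrow> ('a \<Rightarrow> 'a \<Rightarrow>\<^sub>L real) \<Rightarrow> 'a \<Rightarrow> 'a \<Rightarrow> real" where
  "bregman \<psi> \<psi>' x y = \<psi> x - \<psi> y - blinfun_apply (\<psi>' y) (x - y)"

lemma bregman_gradient_independent:
  fixes \<psi> :: "'a::real_normed_vector \<Rightarrow> real"
  assumes "convex Q" "x \<in> Q" "y \<in> Q"
    and 1: "(\<psi> has_derivative blinfun_apply (g y)) (at y within Q)"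
    and 2: "(\<psi> has_derivative blinfun_apply (h y)) (at y within Q)"
  shows "bregman \<psi> g x y = bregman \<psi> h x y"
proof -
  let ?l = "\<lambda>t::real. y + t *\<^sub>R (x - y)"
  have sub: "?l ` {0..1} \<subseteq> Q"
  proof
    fix z assume "z \<in> ?l ` {0..1}"
    then obtain t where t: "t \<in> {0..1}" "z = (1 - t) *\<^sub>R y + t *\<^sub>R x"
      by (auto simp: algebra_simps)
    then show "z \<in> Q"
      using assms(1-3) by (auto simp: convex_alt)
  qed
  have *: "((\<lambda>t. \<psi> (?l t)) has_real_derivative blinfun_apply k (x - y)) (at 0 within {0..1})"
    if "(\<psi> has_derivative blinfun_apply k) (at y within Q)" for k
  proof -
    have "(?l has_derivative (\<lambda>t. t *\<^sub>R (x - y))) (at 0 within {0..1})"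
      by (auto intro!: derivative_eq_intros)
    moreover have "(\<psi> has_derivative blinfun_apply k) (at (?l 0) within ?l ` {0..1})"
      using has_derivative_subset[OF that sub] by simp
    ultimately have "((\<lambda>t. \<psi> (?l t)) has_derivative (\<lambda>t. blinfun_apply k (t *\<^sub>R (x - y)))) (at 0 within {0..1})"
      by (rule has_derivative_in_compose)
    then show ?thesis
      by (simp add: has_field_derivative_def blinfun.scaleR_right mult.commute[of _ "blinfun_apply _ _"])
  qed
  have "at (0::real) within {0..1} \<noteq> bot"
    by (simp add: trivial_limit_within islimpt_Icc)
  then have "blinfun_apply (g y) (x - y) = blinfun_apply (h y) (x - y)"
    by (rule vector_derivative_unique_within)
       (use *[OF 1] *[OF 2] in \<open>simp_all add: has_real_derivative_iff_has_vector_derivative\<close>)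
  then show ?thesis by (simp add: bregman_def)
qed

definition delta_monotone_on ::
    "real \<Rightarrow> 'a::real_normed_vector set \<Rightarrow> ('a \<Rightarrow> 'a \<Rightarrow>\<^sub>L real) \<Rightarrow> bool" where
  "delta_monotone_on \<delta> Q F \<longleftrightarrow>
     (\<forall>x\<in>Q. \<forall>y\<in>Q. blinfun_apply (F y - F x) (y - x) \<ge> - \<delta>)"

definition restricted_gap ::
    "'a::real_normed_vector set \<Rightarrow> ('a \<Rightarrow> 'a \<Rightarrow>\<^sub>L real) \<Rightarrow> 'a \<Rightarrow> real" where
  "restricted_gap Q F z = (SUP u\<in>Q. blinfun_apply (F u) (z - u))"

text \<open>Under the standing assumptions the supremum is a maximum:\<close>

lemma restricted_gap_is_max:
  assumes "compact Q" "Q \<noteq> {}" "continuous_on Q F"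
  obtains u where "u \<in> Q" "restricted_gap Q F z = blinfun_apply (F u) (z - u)"
    "\<And>v. v \<in> Q \<Longrightarrow> blinfun_apply (F v) (z - v) \<le> restricted_gap Q F z"
proof -
  have "continuous_on Q (\<lambda>u. blinfun_apply (F u) (z - u))"
    using assms(3) by (intro continuous_intros)
  then obtain u where u: "u \<in> Q"
      "\<forall>v\<in>Q. blinfun_apply (F v) (z - v) \<le> blinfun_apply (F u) (z - u)"
    using continuous_attains_sup[OF assms(1,2)] by blast
  then have "restricted_gap Q F z = blinfun_apply (F u) (z - u)"
    unfolding restricted_gap_def by (intro cSup_eq_maximum) auto
  with u that show thesis by auto
qed

end

theory Submission
  imports Defs
begin

text \<open>
  First-order optimality of the mirror step, the three-point identity for the Bregman divergence
  and Young's inequality (with strong convexity absorbing the quadratic term) give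
  \<open>\<langle>F x\<^sub>k, x\<^sub>k - u\<rangle> \<le> (V u x\<^sub>k - V u x\<^sub>k\<^sub>+\<^sub>1) / \<gamma>\<^sub>k + \<gamma>\<^sub>k L\<^sup>2 / (2 \<sigma>)\<close>.
  Summing by parts with \<open>V \<le> R\<close> and \<open>1 / \<gamma>\<^sub>k\<close> increasing bounds the first part by \<open>R / \<gamma>\<^sub>N\<close>;
  the second is controlled by \<open>\<Sum>k\<le>N. 1 / sqrt k \<le> 2 * sqrt N\<close>. Finally \<open>\<delta>\<close>-monotonicity
  replaces \<open>F x\<^sub>k\<close> by \<open>F u\<close>.
\<close>

text \<open>A negative right derivative would push \<open>h\<close> below \<open>h 0\<close> just to
  the right of 0. Both the optimality condition of the mirror step and the quadratic lower bound on
  the divergence reduce to this one-dimensional fact.\<close>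

lemma right_derivative_nonneg_at_min:
  fixes h :: "real \<Rightarrow> real"
  assumes D: "(h has_real_derivative D) (at 0 within {0..1})"
    and le: "\<And>t. t \<in> {0..1} \<Longrightarrow> h 0 \<le> h t"
  shows "0 \<le> D"
proof (rule ccontr)
  assume "\<not> 0 \<le> D"
  then obtain d where d: "d > 0" "\<And>t. t > 0 \<Longrightarrow> 0 + t \<in> {0..1} \<Longrightarrow> t < d \<Longrightarrow> h (0 + t) < h 0"
    using has_real_derivative_neg_dec_right[OF D] by auto
  define t where "t = min 1 (d / 2)"
  have "t > 0" "t \<in> {0..1}" "t < d"
    using d(1) by (auto simp: t_def)
  then show False
    using d(2)[of t] le[of t] by auto
qed

lemma segment_in_convex:
  assumes "convex Q" "x \<in> Q" "y \<in> Q" "t \<in> {0..1}"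
  shows "y + t *\<^sub>R (x - y) \<in> Q"
proof -
  have "(1 - t) *\<^sub>R y + t *\<^sub>R x \<in> Q"
    using assms by (auto simp: convex_alt)
  then show ?thesis by (simp add: algebra_simps)
qed

text \<open>Chain rule along a segment that convexity keeps inside \<open>Q\<close>. The derivative
  is one-sided, so \<open>y\<close> may be a boundary point of \<open>Q\<close>.\<close>

lemma has_real_derivative_along_segment:
  fixes \<psi> :: "'a::real_normed_vector \<Rightarrow> real" and f :: "'a \<Rightarrow>\<^sub>L real"
  assumes "convex Q" "x \<in> Q" "y \<in> Q"
    and deriv: "(\<psi> has_derivative blinfun_apply f) (at y within Q)"
  shows "((\<lambda>t. \<psi> (y + t *\<^sub>R (x - y))) has_real_derivative f (x - y)) (at 0 within {0..1})"
proof -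
  let ?l = "\<lambda>t::real. y + t *\<^sub>R (x - y)"
  have sub: "?l ` {0..1} \<subseteq> Q"
    using segment_in_convex[OF assms(1-3)] by auto
  have "(?l has_derivative (\<lambda>t. t *\<^sub>R (x - y))) (at 0 within {0..1})"
    by (auto intro!: derivative_eq_intros)
  moreover have "(\<psi> has_derivative f) (at (?l 0) within ?l ` {0..1})"
    using has_derivative_subset[OF deriv sub] by simp
  ultimately have "((\<lambda>t. \<psi> (?l t)) has_derivative (\<lambda>t. f (t *\<^sub>R (x - y)))) (at 0 within {0..1})"
    by (rule has_derivative_in_compose)
  then show ?thesis
    by (simp add: has_field_derivative_def blinfun.scaleR_right mult.commute[of _ "blinfun_apply _ _"])
qed

text \<open>Restricted to the segment from \<open>z\<close> to \<open>u\<close>, \<phi> attains its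
  minimum at the left endpoint, so its one-sided slope there cannot be negative.\<close>

lemma derivative_nonneg_at_constrained_min:
  fixes \<phi> :: "'a::real_normed_vector \<Rightarrow> real" and f :: "'a \<Rightarrow>\<^sub>L real"
  assumes "convex Q" "u \<in> Q" "z \<in> Q"
    and "(\<phi> has_derivative blinfun_apply f) (at z within Q)"
    and min: "\<And>v. v \<in> Q \<Longrightarrow> \<phi> z \<le> \<phi> v"
  shows "0 \<le> f (u - z)"
  by (rule right_derivative_nonneg_at_min[OF has_real_derivative_along_segment[OF assms(1-4)]])
     (use min segment_in_convex[OF assms(1-3)] in simp)

text \<open>In the usual proof the strong convexity inequality is divided by \<open>t\<close> and
  \<open>t\<close> tends to 0; here the one-sided derivative at 0 takes the place of that
  limit.\<close>

lemma bregman_lower_bound: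
  fixes \<psi> :: "'a::real_normed_vector \<Rightarrow> real"
  assumes sc: "strongly_convex_on \<sigma> Q \<psi>" and "x \<in> Q" "y \<in> Q"
    and deriv: "(\<psi> has_derivative blinfun_apply (\<psi>' y)) (at y within Q)"
  shows "\<sigma> / 2 * (norm (x - y))\<^sup>2 \<le> bregman \<psi> \<psi>' x y"
proof -
  have cvx: "convex Q"
    using sc by (simp add: strongly_convex_on_def)
  define c where "c = \<sigma> / 2 * (norm (x - y))\<^sup>2"
  \<comment> \<open>Up to the additive constant \<open>\<psi> y\<close>, \<open>h t\<close> is the
    slack of the strong convexity inequality at \<open>t\<close>. The slack is nonnegative and
    vanishes at 0, and its right derivative there is the divergence minus \<open>c\<close>.\<close>
  define h where "h t = t * (\<psi> x - \<psi> y) - c * (t * (1 - t)) - \<psi> (y + t *\<^sub>R (x - y))" for t :: real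
  have "(h has_real_derivative (\<psi> x - \<psi> y) - c - \<psi>' y (x - y)) (at 0 within {0..1})"
    unfolding h_def
    by (rule derivative_eq_intros refl has_real_derivative_along_segment[OF cvx assms(2,3) deriv])+ simp
  moreover have "h 0 \<le> h t" if t: "t \<in> {0..1}" for t
  proof -
    have eq: "y + t *\<^sub>R (x - y) = t *\<^sub>R x + (1 - t) *\<^sub>R y"
      by (simp add: algebra_simps)
    have "\<psi> (t *\<^sub>R x + (1 - t) *\<^sub>R y)
        \<le> t * \<psi> x + (1 - t) * \<psi> y - \<sigma> / 2 * t * (1 - t) * (norm (x - y))\<^sup>2"
      using sc assms(2,3) t unfolding strongly_convex_on_def by blast
    then show ?thesis
      unfolding h_def eq by (simp add: c_def algebra_simps)
  qed
  ultimately have "0 \<le> (\<psi> x - \<psi> y) - c - \<psi>' y (x - y)"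
    by (rule right_derivative_nonneg_at_min)
  then show ?thesis
    by (simp add: bregman_def c_def)
qed

lemma bregman_three_point:
  "bregman \<psi> \<psi>' u y - bregman \<psi> \<psi>' u z - bregman \<psi> \<psi>' z y = blinfun_apply (\<psi>' z - \<psi>' y) (u - z)"
  by (simp add: bregman_def blinfun.diff_left blinfun.diff_right)

lemma young_inequality_weighted:
  fixes a b \<sigma> :: real
  assumes "\<sigma> > 0"
  shows "a * b \<le> a\<^sup>2 / (2 * \<sigma>) + \<sigma> / 2 * b\<^sup>2"
proof -
  have "a\<^sup>2 / (2 * \<sigma>) + \<sigma> / 2 * b\<^sup>2 - a * b = (a - \<sigma> * b)\<^sup>2 / (2 * \<sigma>)"
    using assms by (simp add: field_simps power2_eq_square)
  moreover have "0 \<le> (a - \<sigma> * b)\<^sup>2 / (2 * \<sigma>)"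
    using assms by simp
  ultimately show ?thesis by linarith
qed

text \<open>Split \<open>g (y - u)\<close> as \<open>g (z - u) + g (y - z)\<close>. Optimality of
  \<open>z\<close> bounds the first part and leaves a gain of
  \<open>1 / \<gamma> * bregman \<psi> \<psi>' z y\<close>, which pays exactly for the loss in the
  second part.\<close>

lemma mirror_step_bound:
  fixes \<psi> :: "'a::real_normed_vector \<Rightarrow> real" and g :: "'a \<Rightarrow>\<^sub>L real"
  assumes sigma: "\<sigma> > 0" and sc: "strongly_convex_on \<sigma> Q \<psi>"
    and deriv: "\<And>y. y \<in> Q \<Longrightarrow> (\<psi> has_derivative blinfun_apply (\<psi>' y)) (at y within Q)"
    and gamma: "\<gamma> > 0" and g: "norm g \<le> L" and y: "y \<in> Q" and u: "u \<in> Q"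
    and step: "is_arg_min (\<lambda>w. g w + 1 / \<gamma> * bregman \<psi> \<psi>' w y) (\<lambda>w. w \<in> Q) z"
  shows "g (y - u) \<le> 1 / \<gamma> * (bregman \<psi> \<psi>' u y - bregman \<psi> \<psi>' u z) + \<gamma> * L\<^sup>2 / (2 * \<sigma>)"
proof -
  let ?V = "bregman \<psi> \<psi>'"
  have z: "z \<in> Q"
    using step by (simp add: is_arg_min_def)
  have cvx: "convex Q"
    using sc by (simp add: strongly_convex_on_def)
  have "((\<lambda>w. g w + 1 / \<gamma> * ?V w y) has_derivative blinfun_apply (g + (1 / \<gamma>) *\<^sub>R (\<psi>' z - \<psi>' y)))
      (at z within Q)"
    unfolding bregman_def
    by (rule derivative_eq_intros refl deriv[OF z] bounded_linear.has_derivative[OF blinfun.bounded_linear_right])+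
       (auto simp: blinfun.add_left blinfun.scaleR_left blinfun.diff_left)
  then have "0 \<le> blinfun_apply (g + (1 / \<gamma>) *\<^sub>R (\<psi>' z - \<psi>' y)) (u - z)"
    by (rule derivative_nonneg_at_constrained_min[OF cvx u z])
       (use step in \<open>auto simp: is_arg_min_def not_less\<close>)
  then have "0 \<le> g (u - z) + 1 / \<gamma> * (?V u y - ?V u z - ?V z y)"
    unfolding bregman_three_point by (simp add: blinfun.add_left blinfun.scaleR_left)
  then have opt: "g (z - u) \<le> 1 / \<gamma> * (?V u y - ?V u z) - 1 / \<gamma> * ?V z y"
    by (simp add: blinfun.diff_right right_diff_distrib)
  have "g (y - z) \<le> norm g * norm (y - z)"
    using norm_blinfun[of g "y - z"] by simp
  also have "\<dots> \<le> L * norm (y - z)"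
    using g by (simp add: mult_right_mono)
  \<comment> \<open>Pulling out \<open>1 / \<gamma>\<close> before Young's inequality makes its
    quadratic term match the lower bound on the divergence with the right weight.\<close>
  also have "\<dots> = 1 / \<gamma> * ((\<gamma> * L) * norm (z - y))"
    using gamma by (simp add: norm_minus_commute)
  also have "\<dots> \<le> 1 / \<gamma> * ((\<gamma> * L)\<^sup>2 / (2 * \<sigma>) + \<sigma> / 2 * (norm (z - y))\<^sup>2)"
    using gamma by (intro mult_left_mono young_inequality_weighted sigma) auto
  also have "\<dots> \<le> 1 / \<gamma> * ((\<gamma> * L)\<^sup>2 / (2 * \<sigma>) + ?V z y)"
    using gamma bregman_lower_bound[of \<sigma> Q \<psi> z y \<psi>', OF sc z y deriv[OF y]] by (intro mult_left_mono) auto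
  also have "\<dots> = \<gamma> * L\<^sup>2 / (2 * \<sigma>) + 1 / \<gamma> * ?V z y"
    using gamma sigma by (simp add: field_simps power2_eq_square)
  finally show ?thesis
    using opt by (simp add: blinfun.diff_right)
qed

text \<open>Carrying the term \<open>a n * v (n + 1)\<close> makes the summation by parts a plain induction.\<close>

lemma sum_weighted_differences_bound:
  fixes a v :: "nat \<Rightarrow> real"
  assumes "n \<ge> 1" and "0 \<le> a 1" and "\<And>k. 1 \<le> k \<Longrightarrow> a k \<le> a (Suc k)"
    and "\<And>k. 1 \<le> k \<Longrightarrow> k \<le> n \<Longrightarrow> v k \<le> R"
  shows "(\<Sum>k=1..n. a k * (v k - v (Suc k))) + a n * v (Suc n) \<le> a n * R"
  using assms(1,4)
proof (induction n rule: nat_induct_at_least)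
  case base
  then show ?case
    using assms(2) mult_left_mono[of "v 1" R "a 1"] by (simp add: algebra_simps)
next
  case (Suc n)
  have "(a (Suc n) - a n) * v (Suc n) \<le> (a (Suc n) - a n) * R"
    using assms(3)[OF Suc.hyps] Suc.prems[of "Suc n"] by (intro mult_left_mono) auto
  then show ?case
    using Suc.IH Suc.prems by (simp add: algebra_simps)
qed

text \<open>Each term is at most the telescoping difference
  \<open>2 * (sqrt (n + 1) - sqrt n)\<close>; this follows from the square of that difference of
  roots being nonnegative.\<close>

lemma sum_inverse_sqrt_le: "(\<Sum>k=1..n. 1 / sqrt (real k)) \<le> 2 * sqrt (real n)"
proof (induction n)
  case (Suc n)
  let ?a = "sqrt (real n)" and ?b = "sqrt (real (Suc n))"
  have b: "?b > 0" "?a \<le> ?b" and sq: "?b * ?b = ?a * ?a + 1"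
    by (auto simp flip: power2_eq_square)
  have "0 \<le> (?b - ?a)\<^sup>2" by simp
  then have "1 \<le> 2 * (?b - ?a) * ?b"
    using sq by (simp add: power2_eq_square algebra_simps)
  then have "1 / ?b \<le> 2 * (?b - ?a)"
    using b(1) by (simp add: divide_le_eq)
  then show ?case
    using Suc by simp
qed simp

theorem corollary3p7:
  fixes Q :: "'a::real_normed_vector set"
    and \<psi> :: "'a \<Rightarrow> real" and \<psi>' :: "'a \<Rightarrow> 'a \<Rightarrow>\<^sub>L real"
    and F :: "'a \<Rightarrow> 'a \<Rightarrow>\<^sub>L real"
    and \<sigma> R L\<^sub>F \<delta> :: real
    and N :: nat and x :: "nat \<Rightarrow> 'a" and \<gamma> :: "nat \<Rightarrow> real"
  assumes finite_dim: "\<exists>B :: 'a set. finite B \<and> span B = UNIV"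
    and Q: "Q \<noteq> {}" "convex Q" "compact Q"
    and psi_closed: "closed (epigraph Q \<psi>)"
    and psi_deriv: "\<And>y. y \<in> Q \<Longrightarrow> (\<psi> has_derivative blinfun_apply (\<psi>' y)) (at y within Q)"
    and sigma: "\<sigma> > 0" and psi_strong: "strongly_convex_on \<sigma> Q \<psi>"
    and R: "R > 0" "\<And>y z. y \<in> Q \<Longrightarrow> z \<in> Q \<Longrightarrow> bregman \<psi> \<psi>' y z \<le> R"
    and F_cont: "continuous_on Q F"
    and F_bounded: "L\<^sub>F > 0" "\<And>y. y \<in> Q \<Longrightarrow> norm (F y) \<le> L\<^sub>F"
    and F_mono: "\<delta> \<ge> 0" "delta_monotone_on \<delta> Q F"
    and N: "N \<ge> 1"
    and steps: "\<And>k. k \<in> {1..N} \<Longrightarrow> \<gamma> k = sqrt (2 * \<sigma>) / (L\<^sub>F * sqrt (real k))"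
    and x1: "x 1 \<in> Q"
    and iter: "\<And>k. k \<in> {1..N} \<Longrightarrow>
        is_arg_min (\<lambda>z. blinfun_apply (F (x k)) z + 1 / \<gamma> k * bregman \<psi> \<psi>' z (x k))
          (\<lambda>z. z \<in> Q) (x (k + 1))"
  shows "restricted_gap Q F ((1 / real N) *\<^sub>R (\<Sum>k=1..N. x k))
           \<le> L\<^sub>F * (2 + R) / sqrt (2 * \<sigma>) * (1 / sqrt (real N)) + \<delta>
       \<and> (\<lambda>n::nat. L\<^sub>F * (2 + R) / sqrt (2 * \<sigma>) * (1 / sqrt (real n)))
           \<in> O(\<lambda>n. 1 / sqrt (real n))"
proof
  \<comment> \<open>The constant is chosen so that \<open>1 / \<gamma> k = c * sqrt k\<close>; the
    quadratic error of step \<open>k\<close> is then \<open>c / sqrt k\<close>.\<close>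
  define c where "c = L\<^sub>F / sqrt (2 * \<sigma>)"
  define s where "s = sqrt (real N)"
  let ?V = "bregman \<psi> \<psi>'"
  let ?xbar = "(1 / real N) *\<^sub>R (\<Sum>k=1..N. x k)"
  have c: "c > 0" and s: "s > 0" "real N = s * s"
    using F_bounded(1) sigma N by (auto simp: c_def s_def)
  \<comment> \<open>The range reaches \<open>N + 1\<close>: the last iterate is not averaged, but it
    appears in the final divergence term.\<close>
  have x_in: "x k \<in> Q" if "k \<in> {1..Suc N}" for k
  proof (cases "k = 1")
    case False
    then show ?thesis
      using that iter[of "k - 1"] by (cases k) (auto simp: is_arg_min_def)
  qed (use x1 in simp)
  have gamma_pos: "\<gamma> k > 0" and gamma_inv: "1 / \<gamma> k = c * sqrt (real k)"
    and gamma_quad: "\<gamma> k * L\<^sub>F\<^sup>2 / (2 * \<sigma>) = c * (1 / sqrt (real k))" if k: "k \<in> {1..N}" for k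
  proof -
    have "sqrt (2 * \<sigma>) * sqrt (2 * \<sigma>) = 2 * \<sigma>"
      using sigma by simp
    \<comment> \<open>Writing \<open>2 * \<sigma>\<close> as \<open>q * q\<close> turns the
      step-size identities into rational ones.\<close>
    then obtain q where q: "q > 0" "sqrt (2 * \<sigma>) = q" "2 * \<sigma> = q * q"
      using sigma by (metis mult_pos_pos real_sqrt_gt_0_iff zero_less_numeral)
    have "sqrt (real k) > 0"
      using k by simp
    then show "\<gamma> k > 0" "1 / \<gamma> k = c * sqrt (real k)"
        "\<gamma> k * L\<^sub>F\<^sup>2 / (2 * \<sigma>) = c * (1 / sqrt (real k))"
      using F_bounded(1) q(1) unfolding steps[OF k] c_def q(2,3)
      by (simp_all add: field_simps power2_eq_square)
  qed
  have bound: "F u (?xbar - u) \<le> c * (2 + R) / s + \<delta>" if u: "u \<in> Q" for u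
  proof -
    have step: "F u (x k - u) \<le> c * sqrt (real k) * (?V u (x k) - ?V u (x (Suc k)))
        + c * (1 / sqrt (real k)) + \<delta>" if k: "k \<in> {1..N}" for k
    proof -
      \<comment> \<open>Passing to \<open>F u\<close> before summing gives one fixed linear
        functional, which commutes with averaging the iterates.\<close>
      have "F u (x k - u) \<le> F (x k) (x k - u) + \<delta>"
        using F_mono(2) u x_in[of k] k unfolding delta_monotone_on_def
        by (force simp: blinfun.diff_left)
      moreover have "F (x k) (x k - u) \<le> 1 / \<gamma> k * (?V u (x k) - ?V u (x (k + 1)))
          + \<gamma> k * L\<^sub>F\<^sup>2 / (2 * \<sigma>)"
        using k x_in[of k] by (intro mirror_step_bound[OF sigma psi_strong psi_deriv] iter u
          gamma_pos F_bounded(2)) auto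
      ultimately show ?thesis
        unfolding gamma_inv[OF k] gamma_quad[OF k] by simp
    qed
    \<comment> \<open>This allows the boundary term left by the summation by parts to be
      dropped.\<close>
    have V_nonneg: "0 \<le> ?V u (x (Suc N))"
    proof -
      have "x (Suc N) \<in> Q"
        by (rule x_in) simp
      then have "\<sigma> / 2 * (norm (u - x (Suc N)))\<^sup>2 \<le> ?V u (x (Suc N))"
        using psi_strong u psi_deriv by (blast intro: bregman_lower_bound)
      moreover have "0 \<le> \<sigma> / 2 * (norm (u - x (Suc N)))\<^sup>2"
        using sigma by simp
      ultimately show ?thesis by linarith
    qed
    have "(\<Sum>k=1..N. F u (x k - u)) \<le> (\<Sum>k=1..N. c * sqrt (real k) * (?V u (x k) - ?V u (x (Suc k)))
        + c * (1 / sqrt (real k)) + \<delta>)"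
      by (rule sum_mono) (rule step)
    also have "\<dots> = (\<Sum>k=1..N. c * sqrt (real k) * (?V u (x k) - ?V u (x (Suc k))))
        + c * (\<Sum>k=1..N. 1 / sqrt (real k)) + real N * \<delta>"
      by (simp only: sum.distrib sum_distrib_left) simp
    also have "\<dots> \<le> c * s * R + c * (2 * s) + real N * \<delta>"
    proof -
      \<comment> \<open>The weights are \<open>a k = c * sqrt k\<close>, the reciprocal step sizes,
        which increase with \<open>k\<close>.\<close>
      have "(\<Sum>k=1..N. c * sqrt (real k) * (?V u (x k) - ?V u (x (Suc k))))
          + c * sqrt (real N) * ?V u (x (Suc N)) \<le> c * sqrt (real N) * R"
        using N c R(2)[OF u] x_in
        by (intro sum_weighted_differences_bound) auto
      moreover have "0 \<le> c * sqrt (real N) * ?V u (x (Suc N))"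
        using c V_nonneg by simp
      moreover have "c * (\<Sum>k=1..N. 1 / sqrt (real k)) \<le> c * (2 * s)"
        using c sum_inverse_sqrt_le[of N] unfolding s_def by (intro mult_left_mono) auto
      ultimately show ?thesis
        by (simp add: s_def)
    qed
    finally have total: "(\<Sum>k=1..N. F u (x k - u)) \<le> c * s * R + c * (2 * s) + real N * \<delta>" .
    have "F u (?xbar - u) = (1 / real N) * (\<Sum>k=1..N. F u (x k - u))"
      using N by (simp add: blinfun.diff_right blinfun.scaleR_right blinfun.sum_right
          sum_subtractf field_simps)
    also have "\<dots> \<le> (1 / real N) * (c * s * R + c * (2 * s) + real N * \<delta>)"
      using total by (intro mult_left_mono) auto
    also have "\<dots> = c * (2 + R) / s + \<delta>"
      using s(1) unfolding s(2) by (simp add: field_simps)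
    finally show ?thesis .
  qed
  have "restricted_gap Q F ?xbar \<le> c * (2 + R) / s + \<delta>"
    unfolding restricted_gap_def by (rule cSUP_least[OF Q(1) bound])
  then show "restricted_gap Q F ?xbar
      \<le> L\<^sub>F * (2 + R) / sqrt (2 * \<sigma>) * (1 / sqrt (real N)) + \<delta>"
    by (simp add: c_def s_def)
  show "(\<lambda>n::nat. L\<^sub>F * (2 + R) / sqrt (2 * \<sigma>) * (1 / sqrt (real n)))
      \<in> O(\<lambda>n. 1 / sqrt (real n))"
    by (rule bigoI[where c = "\<bar>L\<^sub>F * (2 + R) / sqrt (2 * \<sigma>)\<bar>"]) (simp add: abs_mult)
qed

end
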